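(* (Progress.) Let $t$ be a term and $\rho$ a type such that $\emptyset;\emptyset\vdash t:\rho$ (empty variable context and empty continuation context). Then either $t$ is a value, or there exists a term $t'$ with $t\to t'$.
   Context: Calculus $\lambda^{::}_{\mathtt{catch}}$. Types: $\sigma,\tau,\rho ::= \mathtt{unit} \mid \mathtt{list}\,\tau \mid \sigma\to\tau$. A type is arrow-free if it contains no $\to$; $\psi$ ranges over arrow-free types. Terms: $t,r,s ::= x \mid () \mid \mathtt{nil} \mid (::) \mid \mathtt{lrec} \mid \lambda x.r \mid t\,s \mid \mathtt{catch}\,\alpha\,t \mid \mathtt{throw}\,\alpha\,t$ ($x$ variables, $\alpha,\beta$ continuation variables; $\lambda x$ binds $x$, $\mathtt{catch}\,\alpha$ binds $\alpha$; application left-associative; $t::r$ abbreviates $(::)\,t\,r$). $\mathrm{FCV}$ = free continuation variables, $t[x:=r]$ capture-avoiding substitution. Values: $v,w ::= x \mid () \mid \mathtt{nil} \mid (::) \mid (::)\,v \mid (::)\,v\,w \mid \mathtt{lrec} \mid \mathtt{lrec}\,v \mid \mathtt{lrec}\,v\,w \mid \lambda x.r$. Contexts $E ::= \Box\,t \mid v\,\Box \mid \mathtt{throw}\,\alpha\,\Box$. Reduction $\to$ is the compatible closure of: $(\lambda x.t)\,v \to t[x:=v]$; $E[\mathtt{throw}\,\alpha\,t]\to\mathtt{throw}\,\alpha\,t$; $\mathtt{catch}\,\alpha\,(\mathtt{throw}\,\alpha\,t)\to\mathtt{catch}\,\alpha\,t$; $\mathtt{catch}\,\alpha\,(\mathtt{throw}\,\beta\,v)\to\mathtt{throw}\,\beta\,v$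 if $\alpha\notin\{\beta\}\cup\mathrm{FCV}(v)$; $\mathtt{catch}\,\alpha\,v\to v$ if $\alpha\notin\mathrm{FCV}(v)$; $\mathtt{lrec}\,v_r\,v_s\,\mathtt{nil}\to v_r$; $\mathtt{lrec}\,v_r\,v_s\,(v_h::v_t)\to v_s\,v_h\,v_t\,(\mathtt{lrec}\,v_r\,v_s\,v_t)$. Typing $\Gamma;\Delta\vdash t:\rho$ ($\Delta$ maps continuation variables to arrow-free types): $x:\rho$ if $x:\rho\in\Gamma$; $():\mathtt{unit}$; $\mathtt{nil}:\mathtt{list}\,\sigma$; $(::):\sigma\to\mathtt{list}\,\sigma\to\mathtt{list}\,\sigma$; $\mathtt{lrec}:\rho\to(\sigma\to\mathtt{list}\,\sigma\to\rho\to\rho)\to\mathtt{list}\,\sigma\to\rho$; $\lambda$-introduction and application as usual for simple types; if $\Gamma;\Delta,\alpha:\psi\vdash t:\psi$ then $\Gamma;\Delta\vdash\mathtt{catch}\,\alpha\,t:\psi$ ($\psi$ arrow-free); if $\Gamma;\Delta\vdash t:\psi$ and $\alpha:\psi\in\Delta$ then $\Gamma;\Delta\vdash\mathtt{throw}\,\alpha\,t:\tau$ for any $\tau$. *)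

theory Defs
  imports Main
begin

datatype ty = TUnit | TList ty | TFun ty ty

primrec arrow_free :: "ty \<Rightarrow> bool" where
  "arrow_free TUnit \<longleftrightarrow> True"
| "arrow_free (TList \<tau>) \<longleftrightarrow> arrow_free \<tau>"
| "arrow_free (TFun \<sigma> \<tau>) \<longleftrightarrow> False"

text \<open>Terms up to renaming of bound names, by de Bruijn indices.  Variables and continuation
  variables have two independent index spaces: \<open>Lam\<close> binds index 0 of the former, \<open>Catch\<close> binds
  index 0 of the latter.\<close>

datatype trm =
    Var nat
  | Unit
  | LNil
  | LCons
  | LRec
  | Lam trm
  | App trm trm
  | Catch trm
  | Throw nat trm

primrec FCV :: "trm \<Rightarrow> nat set" where
  "FCV (Var x) = {}"
| "FCV Unit = {}"
| "FCV LNil = {}"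
| "FCV LCons = {}"
| "FCV LRec = {}"
| "FCV (Lam t) = FCV t"
| "FCV (App t s) = FCV t \<union> FCV s"
| "FCV (Catch t) = {\<alpha>. Suc \<alpha> \<in> FCV t}"
| "FCV (Throw \<alpha> t) = insert \<alpha> (FCV t)"

text \<open>\<open>lift\<close> and \<open>clift\<close> make room for a new variable, respectively continuation variable, with
  index \<open>k\<close>.\<close>

primrec lift :: "nat \<Rightarrow> trm \<Rightarrow> trm" where
  "lift k (Var x) = Var (if x < k then x else Suc x)"
| "lift k Unit = Unit"
| "lift k LNil = LNil"
| "lift k LCons = LCons"
| "lift k LRec = LRec"
| "lift k (Lam t) = Lam (lift (Suc k) t)"
| "lift k (App t s) = App (lift k t) (lift k s)"
| "lift k (Catch t) = Catch (lift k t)"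
| "lift k (Throw \<alpha> t) = Throw \<alpha> (lift k t)"

primrec clift :: "nat \<Rightarrow> trm \<Rightarrow> trm" where
  "clift k (Var x) = Var x"
| "clift k Unit = Unit"
| "clift k LNil = LNil"
| "clift k LCons = LCons"
| "clift k LRec = LRec"
| "clift k (Lam t) = Lam (clift k t)"
| "clift k (App t s) = App (clift k t) (clift k s)"
| "clift k (Catch t) = Catch (clift (Suc k) t)"
| "clift k (Throw \<alpha> t) = Throw (if \<alpha> < k then \<alpha> else Suc \<alpha>) (clift k t)"

text \<open>\<open>clower k t\<close> re-indexes \<open>t\<close> when the binder of continuation variable \<open>k\<close> is removed.
  It is the inverse of \<open>clift k\<close> and meaningful only if \<open>k \<notin> FCV t\<close>.\<close>

primrec clower :: "nat \<Rightarrow> trm \<Rightarrow> trm" where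
  "clower k (Var x) = Var x"
| "clower k Unit = Unit"
| "clower k LNil = LNil"
| "clower k LCons = LCons"
| "clower k LRec = LRec"
| "clower k (Lam t) = Lam (clower k t)"
| "clower k (App t s) = App (clower k t) (clower k s)"
| "clower k (Catch t) = Catch (clower (Suc k) t)"
| "clower k (Throw \<alpha> t) = Throw (if \<alpha> < k then \<alpha> else \<alpha> - 1) (clower k t)"

lemma clower_clift: "clower k (clift k t) = t"
  by (induction t arbitrary: k) auto

lemma clift_clower: "k \<notin> FCV t \<Longrightarrow> clift k (clower k t) = t"
  by (induction t arbitrary: k) auto

text \<open>\<open>subst k r t\<close> is \<open>t[k := r]\<close>; the variable \<open>k\<close> disappears, so larger indices move down.\<close>

primrec subst :: "nat \<Rightarrow> trm \<Rightarrow> trm \<Rightarrow> trm" where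
  "subst k r (Var x) = (if x < k then Var x else if x = k then r else Var (x - 1))"
| "subst k r Unit = Unit"
| "subst k r LNil = LNil"
| "subst k r LCons = LCons"
| "subst k r LRec = LRec"
| "subst k r (Lam t) = Lam (subst (Suc k) (lift 0 r) t)"
| "subst k r (App t s) = App (subst k r t) (subst k r s)"
| "subst k r (Catch t) = Catch (subst k (clift 0 r) t)"
| "subst k r (Throw \<alpha> t) = Throw \<alpha> (subst k r t)"

inductive is_value :: "trm \<Rightarrow> bool" where
  "is_value (Var x)"
| "is_value Unit"
| "is_value LNil"
| "is_value LCons"
| "is_value v \<Longrightarrow> is_value (App LCons v)"
| "is_value v \<Longrightarrow> is_value w \<Longrightarrow> is_value (App (App LCons v) w)"
| "is_value LRec"
| "is_value v \<Longrightarrow> is_value (App LRec v)"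
| "is_value v \<Longrightarrow> is_value w \<Longrightarrow> is_value (App (App LRec v) w)"
| "is_value (Lam r)"

datatype ctx = CAppL trm | CAppR trm | CThrow nat

primrec is_ctx :: "ctx \<Rightarrow> bool" where
  "is_ctx (CAppL t) \<longleftrightarrow> True"
| "is_ctx (CAppR v) \<longleftrightarrow> is_value v"
| "is_ctx (CThrow \<alpha>) \<longleftrightarrow> True"

primrec fill :: "ctx \<Rightarrow> trm \<Rightarrow> trm" where
  "fill (CAppL t) s = App s t"
| "fill (CAppR v) s = App v s"
| "fill (CThrow \<alpha>) s = Throw \<alpha> s"

inductive contract :: "trm \<Rightarrow> trm \<Rightarrow> bool" where
  beta: "is_value v \<Longrightarrow> contract (App (Lam t) v) (subst 0 v t)"
| throw: "is_ctx E \<Longrightarrow> contract (fill E (Throw \<alpha> t)) (Throw \<alpha> t)"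
| catch_throw_same: "contract (Catch (Throw 0 t)) (Catch t)"
| catch_throw_other: "is_value v \<Longrightarrow> 0 \<notin> {\<beta>} \<union> FCV v \<Longrightarrow>
    contract (Catch (Throw \<beta> v)) (clower 0 (Throw \<beta> v))"
| catch_value: "is_value v \<Longrightarrow> 0 \<notin> FCV v \<Longrightarrow> contract (Catch v) (clower 0 v)"
| lrec_nil: "is_value vr \<Longrightarrow> is_value vs \<Longrightarrow>
    contract (App (App (App LRec vr) vs) LNil) vr"
| lrec_cons: "is_value vr \<Longrightarrow> is_value vs \<Longrightarrow> is_value vh \<Longrightarrow> is_value vt \<Longrightarrow>
    contract (App (App (App LRec vr) vs) (App (App LCons vh) vt))
      (App (App (App vs vh) vt) (App (App (App LRec vr) vs) vt))"

inductive red :: "trm \<Rightarrow> trm \<Rightarrow> bool" where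
  "contract t t' \<Longrightarrow> red t t'"
| "red t t' \<Longrightarrow> red (Lam t) (Lam t')"
| "red t t' \<Longrightarrow> red (App t s) (App t' s)"
| "red s s' \<Longrightarrow> red (App t s) (App t s')"
| "red t t' \<Longrightarrow> red (Catch t) (Catch t')"
| "red t t' \<Longrightarrow> red (Throw \<alpha> t) (Throw \<alpha> t')"

text \<open>In \<open>typing \<Gamma> \<Delta> t \<rho>\<close>, the \<open>i\<close>-th entry of \<open>\<Gamma>\<close> (of \<open>\<Delta>\<close>) is the type of the variable
  (continuation variable) with index \<open>i\<close>.  That \<open>\<Delta>\<close> holds arrow-free types only is imposed
  where an entry is added (\<open>Catch\<close>) and where it is used (\<open>Throw\<close>).\<close>

inductive typing :: "ty list \<Rightarrow> ty list \<Rightarrow> trm \<Rightarrow> ty \<Rightarrow> bool" where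
  "x < length \<Gamma> \<Longrightarrow> \<Gamma> ! x = \<rho> \<Longrightarrow> typing \<Gamma> \<Delta> (Var x) \<rho>"
| "typing \<Gamma> \<Delta> Unit TUnit"
| "typing \<Gamma> \<Delta> LNil (TList \<sigma>)"
| "typing \<Gamma> \<Delta> LCons (TFun \<sigma> (TFun (TList \<sigma>) (TList \<sigma>)))"
| "typing \<Gamma> \<Delta> LRec
    (TFun \<rho> (TFun (TFun \<sigma> (TFun (TList \<sigma>) (TFun \<rho> \<rho>))) (TFun (TList \<sigma>) \<rho>)))"
| "typing (\<sigma> # \<Gamma>) \<Delta> t \<tau> \<Longrightarrow> typing \<Gamma> \<Delta> (Lam t) (TFun \<sigma> \<tau>)"
| "typing \<Gamma> \<Delta> t (TFun \<sigma> \<tau>) \<Longrightarrow> typing \<Gamma> \<Delta> s \<sigma> \<Longrightarrow> typing \<Gamma> \<Delta> (App t s) \<tau>"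
| "arrow_free \<psi> \<Longrightarrow> typing \<Gamma> (\<psi> # \<Delta>) t \<psi> \<Longrightarrow> typing \<Gamma> \<Delta> (Catch t) \<psi>"
| "arrow_free \<psi> \<Longrightarrow> typing \<Gamma> \<Delta> t \<psi> \<Longrightarrow> \<alpha> < length \<Delta> \<Longrightarrow> \<Delta> ! \<alpha> = \<psi> \<Longrightarrow>
    typing \<Gamma> \<Delta> (Throw \<alpha> t) \<tau>"

end

theory Submission
  imports Defs
begin

text \<open>Induction on typing, over an arbitrary continuation context: there a third outcome must be
  allowed, a term \<open>Throw \<alpha> v\<close> with \<open>v\<close> a value, which the empty continuation context rules out.
  In the \<open>Catch\<close> case the side conditions on \<open>FCV\<close> hold because a closed value of arrow-free type
  is built from \<open>Unit\<close>, \<open>LNil\<close> and \<open>LCons\<close> only; this is why \<open>Catch\<close> and \<open>Throw\<close> are restricted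
  to arrow-free types.\<close>

inductive_cases typing_VarE: "typing \<Gamma> \<Delta> (Var x) \<rho>"
inductive_cases typing_UnitE: "typing \<Gamma> \<Delta> Unit \<rho>"
inductive_cases typing_LNilE: "typing \<Gamma> \<Delta> LNil \<rho>"
inductive_cases typing_LConsE: "typing \<Gamma> \<Delta> LCons \<rho>"
inductive_cases typing_LRecE: "typing \<Gamma> \<Delta> LRec \<rho>"
inductive_cases typing_LamE: "typing \<Gamma> \<Delta> (Lam t) \<rho>"
inductive_cases typing_AppE: "typing \<Gamma> \<Delta> (App t s) \<rho>"
inductive_cases typing_ThrowE: "typing \<Gamma> \<Delta> (Throw \<alpha> t) \<rho>"

lemmas value_typing_elims = typing_VarE typing_UnitE typing_LNilE typing_LConsE typing_LRecE
  typing_LamE typing_AppE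

text \<open>Variables are untypable in the empty context; abstractions and partial applications have
  function types. For a cons, arrow-freeness of the list type passes to the head and the
  tail.\<close>

lemma FCV_value_arrow_free:
  assumes "is_value v" "typing [] \<Delta> v \<psi>" "arrow_free \<psi>"
  shows "FCV v = {}"
  using assms
  by (induction v arbitrary: \<psi>) (fastforce elim!: value_typing_elims)+

lemma canonical_TList:
  assumes "is_value v" "typing [] \<Delta> v (TList \<sigma>)"
  obtains "v = LNil" | vh vt where "v = App (App LCons vh) vt" "is_value vh" "is_value vt"
  using assms by cases (auto elim!: value_typing_elims)

text \<open>\<open>LCons\<close> or \<open>LRec\<close> with at most one argument so far yields a
  value again; an abstraction contracts, and \<open>LRec\<close> with two arguments contracts by the
  shape of the list \<open>w\<close>.\<close>

lemma App_values_progress: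
  assumes v: "is_value v" "typing [] \<Delta> v (TFun \<sigma> \<tau>)"
    and w: "is_value w" "typing [] \<Delta> w \<sigma>"
  shows "is_value (App v w) \<or> (\<exists>t'. red (App v w) t')"
  using v(1)
proof cases
  case (9 vr vs)
  then obtain \<sigma>' where "\<sigma> = TList \<sigma>'"
    using v(2) by (auto elim!: value_typing_elims)
  with w(2) have "typing [] \<Delta> w (TList \<sigma>')" by simp
  with w(1) show ?thesis
    by (cases rule: canonical_TList)
      (use 9 in \<open>blast intro: red.intros(1) lrec_nil lrec_cons\<close>)+
next
  case (10 r)
  with w(1) show ?thesis by (blast intro: red.intros(1) beta)
qed (use v w(1) in \<open>auto elim!: value_typing_elims intro: is_value.intros\<close>)

lemma red_fill_Throw: "is_ctx E \<Longrightarrow> \<exists>t'. red (fill E (Throw \<alpha> t)) t'"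
  by (blast intro: red.intros(1) throw)

lemma progress_open_continuations:
  assumes "typing [] \<Delta> t \<rho>"
  shows "is_value t \<or> (\<exists>t'. red t t') \<or> (\<exists>\<alpha> v. t = Throw \<alpha> v \<and> is_value v)"
  using assms
\<comment> \<open>Fixing \<open>[]\<close> leaves \<open>Lam\<close> without a usable induction
  hypothesis, but every abstraction is a value.\<close>
proof (induction "[] :: ty list" \<Delta> t \<rho> rule: typing.induct)
  case (7 \<Delta> t \<sigma> \<tau> s)
  consider "\<exists>t'. red t t'" | \<alpha> v where "t = Throw \<alpha> v"
    | "is_value t" "\<exists>s'. red s s'" | \<alpha> v where "is_value t" "s = Throw \<alpha> v"
    | "is_value t" "is_value s"
    using 7 by blast
  then show ?case
  proof cases
    case 2
    then show ?thesis using red_fill_Throw[of "CAppL s"] by simp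
  next
    case 4
    then show ?thesis using red_fill_Throw[of "CAppR t"] by simp
  next
    case 5
    then show ?thesis using App_values_progress 7 by blast
  qed (blast intro: red.intros)+
next
  case (8 \<psi> \<Delta> t)
  consider "\<exists>t'. red t t'" | "is_value t" | \<alpha> v where "t = Throw \<alpha> v" "is_value v"
    using 8 by blast
  then show ?case
  proof cases
    case 2
    then have "0 \<notin> FCV t" using FCV_value_arrow_free 8 by blast
    with 2 show ?thesis by (blast intro: red.intros(1) catch_value)
  next
    case (3 \<alpha> v)
    then have "FCV v = {}"
      using 8 by (blast elim: typing_ThrowE dest: FCV_value_arrow_free)
    \<comment> \<open>Index 0 is the variable bound by this very \<open>Catch\<close>; any other
      throw escapes it.\<close>
    then have "\<exists>t'. contract (Catch (Throw \<alpha> v)) t'"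
      using catch_throw_same catch_throw_other[OF 3(2), of \<alpha>] by (cases "\<alpha> = 0") auto
    with 3 show ?thesis by (blast intro: red.intros(1))
  qed (blast intro: red.intros)
next
  case (9 \<psi> \<Delta> t \<alpha> \<tau>)
  \<comment> \<open>If \<open>t\<close> is itself a throw, it discards the outer one.\<close>
  then show ?case using red_fill_Throw[of "CThrow \<alpha>"] by (auto intro: red.intros)
qed (auto intro: is_value.intros)

theorem theorem2p15:
  fixes t :: trm and \<rho> :: ty
  assumes "typing [] [] t \<rho>"
  shows "is_value t \<or> (\<exists>t'. red t t')"
  using progress_open_continuations[OF assms] assms by (auto elim: typing_ThrowE)

end
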